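(* Let $d,\ell,m,q \geq 1$ and $r \geq 2$ be integers with $q\ge d$, and let $\mathbb{F}$ be an efficient field. Suppose there exist a set $C \subseteq \mathbb{F}^m$ with $|C| = q$ and a polynomial $p:\mathbb{F}^{m\times(d\ell)}\to\mathbb{F}$ of degree at most $r$ such that the pair $(C,p)$ captures the $(d,\ell,q)$-uniformly rainbow property. Then the $(d,\ell,q)$-Uniformly Rainbow Free Coloring problem parameterized by the number of vertices $n$ admits a kernel with $O(n^r)$ constraints. Moreover, given an instance $(G,\mathcal{F})$, the kernel returns an instance $(G,\mathcal{F}')$ with $\mathcal{F}'\subseteq\mathcal{F}$ such that $(G,\mathcal{F})$ and $(G,\mathcal{F}')$ have the same solution set.
   Context: A field is efficient if field operations and Gaussian elimination over it can be performed in time polynomial in the size of a reasonable input encoding (e.g., finite fields). A polynomial $p:\mathbb{F}^{m\times(d\ell)}\to\mathbb{F}$ is a polynomial in $md\ell$ variables arranged as an $m\times(d\ell)$ matrix. A matrix $M=(a_1,\dots,a_{d\ell})$ (columns $a_i$) is $C$-colored if each $a_i\in C$. The pair $(C,p)$, with $|C|=q$, captures the $(d,\ell,q)$-uniformly rainbow property if for every $C$-colored $M=(a_1,\dots,a_{d\ell})\in\mathbb{F}^{m\times(d\ell)}$, $p(M)\ne0$ iff the sets $F_j=\{a_i:(j-1)d<i\le jd\}$, $j\in[\ell]$, are all equal and of size $d$. For a coloring $c$ of $V$, an $\ell$-tuple $(F_1,\dots,F_\ell)$ of $d$-subsets of $V$ is uniformly rainbow w.r.t. $c$ if the sets $\{c(v):v\in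 F_j\}$ are all equal and of size $d$. The $(d,\ell,q)$-Uniformly Rainbow Free Coloring problem: input is a graph $G=(V,E)$ and a collection $\mathcal{F}$ of $\ell$-tuples of $d$-subsets of $V$; decide whether there is a proper coloring $c:V\to[q]$ of $G$ with no tuple of $\mathcal{F}$ uniformly rainbow. Its solution set is the set of all such colorings; its number of constraints is $|E|+|\mathcal{F}|$; parameter $n=|V|$. A kernel with $O(n^r)$ constraints is a polynomial-time algorithm mapping each instance to an equivalent instance of the same problem with $O(n^r)$ constraints. *)

theory Defs
  imports
    "HOL-Library.FuncSet"
    "HOL-Library.Poly_Mapping"
    "HOL-Computational_Algebra.Polynomial"
    "Jordan_Normal_Form.Gauss_Jordan_Elimination"
begin

section \<open>Polynomial-time computation\<close>

text \<open>
  The machine model is a WHILE language over binary trees (in the style of N. Jones,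
  \<^emph>\<open>Computability and Complexity from a Programming Perspective\<close>), in variable-free form:
  a program transforms a single tree.  Every operation is charged at least the size of the
  trees that it reads or builds, so that (see the lemmas on \<open>runs\<close> below) sharing cannot be
  used to build trees larger than the running time, and polynomial time coincides with
  polynomial time on Turing machines.
\<close>

datatype tree = Leaf | Node tree tree

primrec tsize :: "tree \<Rightarrow> nat" where
  "tsize Leaf = 1"
| "tsize (Node a b) = 1 + tsize a + tsize b"

primrec left :: "tree \<Rightarrow> tree" where
  "left Leaf = Leaf"
| "left (Node a b) = a"

primrec right :: "tree \<Rightarrow> tree" where
  "right Leaf = Leaf"
| "right (Node a b) = b"

text \<open>\<^const>\<open>Leaf\<close> plays the role of false, every other tree that of true.\<close>

definition enc_bool :: "bool \<Rightarrow> tree" where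
  "enc_bool b = (if b then Node Leaf Leaf else Leaf)"

datatype prog =
    Ident
  | Const tree
  | GoLeft
  | GoRight
  | Equal
  | Fork prog prog
  | Seq prog prog
  | Cond prog prog prog
  | While prog prog

text \<open>\<open>runs P x t y\<close>: on input \<open>x\<close>, the program \<open>P\<close> halts after time \<open>t\<close> with output \<open>y\<close>.\<close>

inductive runs :: "prog \<Rightarrow> tree \<Rightarrow> nat \<Rightarrow> tree \<Rightarrow> bool" where
  Ident: "runs Ident x (tsize x) x"
| Const: "runs (Const c) x (tsize x + tsize c) c"
| GoLeft: "runs GoLeft x (tsize x) (left x)"
| GoRight: "runs GoRight x (tsize x) (right x)"
| Equal: "runs Equal x (tsize x + 3) (enc_bool (x \<noteq> Leaf \<and> left x = right x))"
| Fork: "runs P x s y \<Longrightarrow> runs Q x t z \<Longrightarrow> runs (Fork P Q) x (1 + s + t) (Node y z)"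
| Seq: "runs P x s y \<Longrightarrow> runs Q y t z \<Longrightarrow> runs (Seq P Q) x (1 + s + t) z"
| CondTrue: "runs B x s b \<Longrightarrow> b \<noteq> Leaf \<Longrightarrow> runs P x t y \<Longrightarrow> runs (Cond B P Q) x (1 + s + t) y"
| CondFalse: "runs B x s Leaf \<Longrightarrow> runs Q x t y \<Longrightarrow> runs (Cond B P Q) x (1 + s + t) y"
| WhileStop: "runs B x s Leaf \<Longrightarrow> runs (While B P) x (1 + s) x"
| WhileStep: "runs B x s b \<Longrightarrow> b \<noteq> Leaf \<Longrightarrow> runs P x t y \<Longrightarrow> runs (While B P) y u z \<Longrightarrow>
    runs (While B P) x (1 + s + t + u) z"

inductive_cases runs_elims:
  "runs Ident x t y" "runs (Const c) x t y" "runs GoLeft x t y" "runs GoRight x t y"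
  "runs Equal x t y" "runs (Fork P Q) x t y" "runs (Seq P Q) x t y" "runs (Cond B P Q) x t y"
  "runs (While B P) x t y"

lemma runs_deterministic:
  "runs P x t y \<Longrightarrow> runs P x t' y' \<Longrightarrow> t = t' \<and> y = y'"
proof (induction arbitrary: t' y' rule: runs.induct)
  case (Fork P x s y Q t z)
  show ?case by (rule runs_elims(6)[OF Fork.prems]) (auto dest: Fork.IH)
next
  case (Seq P x s y Q t z)
  show ?case by (rule runs_elims(7)[OF Seq.prems]) (auto dest!: Seq.IH)
next
  case (CondTrue B x s b P t y Q)
  show ?case
    by (rule runs_elims(8)[OF CondTrue.prems]) (use CondTrue.hyps in \<open>auto dest!: CondTrue.IH\<close>)
next
  case (CondFalse B x s Q t y P)
  show ?case by (rule runs_elims(8)[OF CondFalse.prems]) (auto dest!: CondFalse.IH)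
next
  case (WhileStop B x s P)
  show ?case by (rule runs_elims(9)[OF WhileStop.prems]) (auto dest!: WhileStop.IH)
next
  case (WhileStep B x s b P t y u z)
  show ?case
    by (rule runs_elims(9)[OF WhileStep.prems]) (use WhileStep.hyps in \<open>auto dest!: WhileStep.IH\<close>)
qed (auto elim: runs_elims)

lemma tsize_pos: "tsize x \<ge> 1"
  by (cases x) auto

lemma runs_time_ge_sizes: "runs P x t y \<Longrightarrow> tsize x \<le> t \<and> tsize y \<le> t"
proof (induction rule: runs.induct)
  case (GoLeft x)
  then show ?case by (cases x) auto
next
  case (GoRight x)
  then show ?case by (cases x) auto
qed (auto simp: enc_bool_def)

definition poly_time_computable ::
    "'a set \<Rightarrow> ('a \<Rightarrow> tree) \<Rightarrow> ('b \<Rightarrow> tree) \<Rightarrow> ('a \<Rightarrow> 'b) \<Rightarrow> bool" where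
  "poly_time_computable D enc_in enc_out f \<longleftrightarrow>
     (\<exists>P (b :: nat poly). \<forall>a\<in>D. \<exists>t. t \<le> poly b (tsize (enc_in a)) \<and>
        runs P (enc_in a) t (enc_out (f a)))"

section \<open>Encodings and efficient fields\<close>

fun enc_nat :: "nat \<Rightarrow> tree" where
  "enc_nat n = (if n = 0 then Leaf else Node (enc_bool (odd n)) (enc_nat (n div 2)))"

declare enc_nat.simps [simp del]

fun enc_list :: "tree list \<Rightarrow> tree" where
  "enc_list [] = Leaf"
| "enc_list (x # xs) = Node x (enc_list xs)"

definition enc_mat :: "('f \<Rightarrow> tree) \<Rightarrow> 'f mat \<Rightarrow> tree" where
  "enc_mat enc A = enc_list (map (\<lambda>row. enc_list (map enc row)) (mat_to_list A))"

text \<open>Equality of field elements needs no separate clause, because the encoding is injective and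
  the machine can compare trees.  \<^const>\<open>gauss_jordan_single\<close> returns the reduced row echelon
  form of a matrix.\<close>

definition efficient_field :: "'f :: field itself \<Rightarrow> bool" where
  "efficient_field _ \<longleftrightarrow> (\<exists>enc :: 'f \<Rightarrow> tree. inj enc \<and>
     poly_time_computable UNIV (\<lambda>(a, b). Node (enc a) (enc b)) enc (\<lambda>(a, b). a + b) \<and>
     poly_time_computable UNIV (\<lambda>(a, b). Node (enc a) (enc b)) enc (\<lambda>(a, b). a * b) \<and>
     poly_time_computable UNIV enc enc (\<lambda>a. - a) \<and>
     poly_time_computable {a. a \<noteq> 0} enc enc inverse \<and>
     poly_time_computable UNIV (enc_mat enc) (enc_mat enc) gauss_jordan_single)"

section \<open>Polynomials in the entries of a matrix\<close>

type_synonym ('v, 'a) mpoly = "('v \<Rightarrow>\<^sub>0 nat) \<Rightarrow>\<^sub>0 'a"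

definition mpoly_vars :: "('v, 'a::zero) mpoly \<Rightarrow> 'v set" where
  "mpoly_vars p = (\<Union>\<mu>\<in>Poly_Mapping.keys p. Poly_Mapping.keys \<mu>)"

definition mpoly_degree :: "('v, 'a::zero) mpoly \<Rightarrow> nat" where
  "mpoly_degree p = Max (insert 0
     ((\<lambda>\<mu>. \<Sum>v\<in>Poly_Mapping.keys \<mu>. Poly_Mapping.lookup \<mu> v) ` Poly_Mapping.keys p))"

definition mpoly_eval :: "('v, 'a::comm_semiring_1) mpoly \<Rightarrow> ('v \<Rightarrow> 'a) \<Rightarrow> 'a" where
  "mpoly_eval p x = (\<Sum>\<mu>\<in>Poly_Mapping.keys p. Poly_Mapping.lookup p \<mu> *
     (\<Prod>v\<in>Poly_Mapping.keys \<mu>. x v ^ Poly_Mapping.lookup \<mu> v))"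

text \<open>The variable \<open>(i, j)\<close> stands for the entry in row \<open>i\<close> and column \<open>j\<close>; rows, columns and
  the blocks of columns below are numbered from 0.\<close>

definition matrix_poly :: "nat \<Rightarrow> nat \<Rightarrow> (nat \<times> nat, 'a::zero) mpoly \<Rightarrow> bool" where
  "matrix_poly nr nc p \<longleftrightarrow> mpoly_vars p \<subseteq> {..<nr} \<times> {..<nc}"

definition colored_mat :: "'a vec set \<Rightarrow> 'a mat \<Rightarrow> bool" where
  "colored_mat C M \<longleftrightarrow> (\<forall>i<dim_col M. col M i \<in> C)"

definition column_block :: "nat \<Rightarrow> 'a mat \<Rightarrow> nat \<Rightarrow> 'a vec set" where
  "column_block d M j = {col M i | i. j * d \<le> i \<and> i < (j + 1) * d}"

definition captures_uniformly_rainbow ::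
    "nat \<Rightarrow> nat \<Rightarrow> nat \<Rightarrow> nat \<Rightarrow> 'a::comm_ring_1 vec set \<Rightarrow> (nat \<times> nat, 'a) mpoly \<Rightarrow> bool" where
  "captures_uniformly_rainbow m d l q C p \<longleftrightarrow>
     card C = q \<and>
     (\<forall>M\<in>carrier_mat m (d * l). colored_mat C M \<longrightarrow>
        (mpoly_eval p (\<lambda>ij. M $$ ij) \<noteq> 0 \<longleftrightarrow>
          (\<forall>j<l. \<forall>k<l. column_block d M j = column_block d M k) \<and>
          (\<forall>j<l. card (column_block d M j) = d)))"

section \<open>Uniformly Rainbow Free Coloring\<close>

record 'v urfc =
  vertices :: "'v set"
  edges :: "'v set set"
  tuples :: "'v set list set"

definition urfc_instance :: "nat \<Rightarrow> nat \<Rightarrow> 'v urfc \<Rightarrow> bool" where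
  "urfc_instance d l I \<longleftrightarrow>
     finite (vertices I) \<and>
     (\<forall>e\<in>edges I. e \<subseteq> vertices I \<and> card e = 2) \<and>
     (\<forall>F\<in>tuples I. length F = l \<and> (\<forall>S\<in>set F. S \<subseteq> vertices I \<and> card S = d))"

definition uniformly_rainbow :: "nat \<Rightarrow> ('v \<Rightarrow> nat) \<Rightarrow> 'v set list \<Rightarrow> bool" where
  "uniformly_rainbow d c F \<longleftrightarrow>
     (\<forall>S\<in>set F. \<forall>T\<in>set F. c ` S = c ` T) \<and> (\<forall>S\<in>set F. card (c ` S) = d)"

definition urfc_solutions :: "nat \<Rightarrow> nat \<Rightarrow> 'v urfc \<Rightarrow> ('v \<Rightarrow> nat) set" where
  "urfc_solutions d q I =
     {c \<in> vertices I \<rightarrow>\<^sub>E {1..q}.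
        (\<forall>u v. {u, v} \<in> edges I \<longrightarrow> c u \<noteq> c v) \<and>
        (\<forall>F\<in>tuples I. \<not> uniformly_rainbow d c F)}"

definition num_constraints :: "'v urfc \<Rightarrow> nat" where
  "num_constraints I = card (edges I) + card (tuples I)"

text \<open>Vertices are natural numbers written in binary.  A finite set is presented to the machine as
  a list of its elements in an arbitrary order and without repetition, so an instance has several
  encodings, and an algorithm has to work on all of them.\<close>

definition encodes_list :: "('a \<Rightarrow> tree \<Rightarrow> bool) \<Rightarrow> 'a list \<Rightarrow> tree \<Rightarrow> bool" where
  "encodes_list R xs t \<longleftrightarrow> (\<exists>ts. list_all2 R xs ts \<and> t = enc_list ts)"

definition encodes_set :: "('a \<Rightarrow> tree \<Rightarrow> bool) \<Rightarrow> 'a set \<Rightarrow> tree \<Rightarrow> bool" where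
  "encodes_set R X t \<longleftrightarrow> (\<exists>xs. distinct xs \<and> set xs = X \<and> encodes_list R xs t)"

definition encodes_vertex :: "nat \<Rightarrow> tree \<Rightarrow> bool" where
  "encodes_vertex v t \<longleftrightarrow> t = enc_nat v"

definition encodes_urfc :: "nat urfc \<Rightarrow> tree \<Rightarrow> bool" where
  "encodes_urfc I t \<longleftrightarrow> (\<exists>tV tE tF. t = Node tV (Node tE tF) \<and>
     encodes_set encodes_vertex (vertices I) tV \<and>
     encodes_set (encodes_set encodes_vertex) (edges I) tE \<and>
     encodes_set (encodes_list (encodes_set encodes_vertex)) (tuples I) tF)"

definition urfc_kernel :: "nat \<Rightarrow> nat \<Rightarrow> nat \<Rightarrow> nat \<Rightarrow> (tree \<Rightarrow> tree) \<Rightarrow> bool" where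
  "urfc_kernel d l q r \<kappa> \<longleftrightarrow>
     poly_time_computable {x. \<exists>I. urfc_instance d l I \<and> encodes_urfc I x} id id \<kappa> \<and>
     (\<exists>K :: nat. \<forall>I x. urfc_instance d l I \<and> encodes_urfc I x \<longrightarrow>
        (\<exists>I'. urfc_instance d l I' \<and> encodes_urfc I' (\<kappa> x) \<and>
           (urfc_solutions d q I \<noteq> {} \<longleftrightarrow> urfc_solutions d q I' \<noteq> {}) \<and>
           num_constraints I' \<le> K * card (vertices I) ^ r))"

subsection \<open>A tree encodes at most one instance\<close>

lemma enc_nat_inject: "enc_nat a = enc_nat b \<Longrightarrow> a = b"
proof (induction a arbitrary: b rule: less_induct)
  case (less a)
  show ?case
  proof (cases "a = 0 \<or> b = 0")
    case True
    then show ?thesis using less.prems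
      by (auto simp: enc_nat.simps[of a] enc_nat.simps[of b] split: if_splits)
  next
    case False
    then have eq: "enc_bool (odd a) = enc_bool (odd b)" "enc_nat (a div 2) = enc_nat (b div 2)"
      using less.prems unfolding enc_nat.simps[of a] enc_nat.simps[of b] by simp_all
    have half: "a div 2 = b div 2" using less.IH[of "a div 2"] False eq(2) by simp
    have parity: "odd a = odd b" using eq(1) by (auto simp: enc_bool_def split: if_splits)
    show ?thesis
      using half parity by presburger
  qed
qed

lemma enc_list_inject: "enc_list xs = enc_list ys \<Longrightarrow> xs = ys"
proof (induction xs arbitrary: ys)
  case Nil
  then show ?case by (cases ys) auto
next
  case (Cons x xs)
  then show ?case by (cases ys) auto
qed

lemma encodes_vertex_unique: "left_unique encodes_vertex"
  by (auto simp: left_unique_def encodes_vertex_def dest: enc_nat_inject)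

lemma encodes_list_unique:
  assumes "left_unique R"
  shows "left_unique (encodes_list R)"
proof (rule left_uniqueI)
  fix xs ys t
  assume "encodes_list R xs t" "encodes_list R ys t"
  then obtain ts where "list_all2 R xs ts" "list_all2 R ys ts"
    by (auto simp: encodes_list_def dest: enc_list_inject)
  then show "xs = ys" by (rule left_uniqueD[OF list.left_unique_rel[OF assms]])
qed

lemma encodes_set_unique:
  assumes "left_unique R"
  shows "left_unique (encodes_set R)"
proof (rule left_uniqueI)
  fix X Y t
  assume "encodes_set R X t" "encodes_set R Y t"
  then obtain xs ys where "set xs = X" "set ys = Y" "encodes_list R xs t" "encodes_list R ys t"
    by (auto simp: encodes_set_def)
  then show "X = Y" using left_uniqueD[OF encodes_list_unique[OF assms], of xs t ys] by simp
qed

lemma encodes_urfc_unique: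
  fixes I J :: "nat urfc"
  assumes "encodes_urfc I t" and "encodes_urfc J t"
  shows "I = J"
proof -
  note 1 = encodes_set_unique[OF encodes_vertex_unique]
  note 2 = encodes_set_unique[OF 1]
  note 3 = encodes_set_unique[OF encodes_list_unique[OF 1]]
  from assms(1) obtain tV tE tF where t: "t = Node tV (Node tE tF)" and
    I: "encodes_set encodes_vertex (vertices I) tV"
       "encodes_set (encodes_set encodes_vertex) (edges I) tE"
       "encodes_set (encodes_list (encodes_set encodes_vertex)) (tuples I) tF"
    unfolding encodes_urfc_def by auto
  from assms(2) have
    J: "encodes_set encodes_vertex (vertices J) tV"
       "encodes_set (encodes_set encodes_vertex) (edges J) tE"
       "encodes_set (encodes_list (encodes_set encodes_vertex)) (tuples J) tF"
    unfolding encodes_urfc_def t by auto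
  show ?thesis
    using left_uniqueD[OF 1 I(1) J(1)] left_uniqueD[OF 2 I(2) J(2)] left_uniqueD[OF 3 I(3) J(3)]
    by simp
qed

end

theory Submission
  imports Defs
begin

text \<open>
  A monomial of degree at most \<open>r\<close> in the entries of the matrix of a tuple depends on at most
  \<open>r\<close> columns, that is, on the colours of the vertices at \<open>r\<close> of the \<open>d * l\<close> positions of the
  tuple.  Describe a tuple by the 0/1 vector indexed by pairs \<open>(J, w)\<close>, where \<open>J\<close> is a list of
  \<open>r\<close> positions, \<open>w\<close> is a list of \<open>r\<close> vertices, and the entry is 1 iff the tuple has \<open>w\<close> at the
  positions \<open>J\<close>.  For every colouring, the value of \<open>p\<close> is then a linear functional of this vector.
  So if the tuples of a spanning subset of these vectors are not uniformly rainbow, then none is,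
  and a basis has at most \<open>(d * l)^r * n^r\<close> elements.  The tuples of a basis are read off from the
  pivots of the reduced row echelon form.  Since the matrix has entries 0 and 1 only, a single call
  of Gaussian elimination suffices and no other field operation is needed.
\<close>

section \<open>Polynomial-time functions on trees\<close>

text \<open>Demanded on all trees, malformed ones included, so that the closure rules below compose
  without side conditions. Restricting to encodings of instances happens only at the very
  end.\<close>

definition ptime :: "(tree \<Rightarrow> tree) \<Rightarrow> bool" where
  "ptime f \<longleftrightarrow> poly_time_computable UNIV id id f"

lemma ptimeI:
  assumes "\<And>x. \<exists>t\<le>poly b (tsize x). runs P x t (f x)"
  shows "ptime f"
  using assms unfolding ptime_def poly_time_computable_def by auto

lemma ptimeE:
  assumes "ptime f"
  obtains P b where "\<And>x. \<exists>t\<le>poly b (tsize x). runs P x t (f x)"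
  using assms unfolding ptime_def poly_time_computable_def by auto

text \<open>Holds because coefficients in \<open>nat\<close> cannot be negative. It turns a bound in
  terms of an intermediate size into one in terms of the input size.\<close>

lemma poly_nat_mono: "x \<le> y \<Longrightarrow> poly b x \<le> poly b y" for b :: "nat poly"
  by (induction b) (auto intro: add_mono mult_mono)

lemma ptime_size_le:
  assumes "ptime f"
  obtains b where "\<And>x. tsize (f x) \<le> poly b (tsize x)"
proof -
  obtain P b where Pb: "\<And>x. \<exists>t\<le>poly b (tsize x). runs P x t (f x)"
    using assms by (rule ptimeE) blast
  have "tsize (f x) \<le> poly b (tsize x)" for x
    using Pb[of x] runs_time_ge_sizes by (meson order_trans)
  then show thesis by (rule that)
qed

lemma ptime_ident: "ptime (\<lambda>x. x)"
  by (rule ptimeI[of "[:0, 1:]" Ident]) (auto intro: runs.Ident)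

lemma ptime_const: "ptime (\<lambda>x. c)"
  by (rule ptimeI[of "[:tsize c, 1:]" "Const c"])
    (auto intro!: exI[of _ "tsize c + tsize _"] simp: add.commute[of "tsize c"] runs.Const)

text \<open>Arbitrary encodings and a domain \<open>E\<close> are allowed for \<open>g\<close>, so
  that an algorithm assumed on encoded objects, such as Gaussian elimination on matrices, can be
  plugged into a function on trees.\<close>

lemma ptime_compose:
  assumes "poly_time_computable E enc_in enc_out g" "ptime (\<lambda>x. enc_in (f x))" "\<And>x. f x \<in> E"
  shows "ptime (\<lambda>x. enc_out (g (f x)))"
proof -
  obtain P b where P: "\<And>x. \<exists>t\<le>poly b (tsize x). runs P x t (enc_in (f x))"
    using assms(2) by (rule ptimeE) blast
  obtain Q c where Q: "\<And>y. y \<in> E \<Longrightarrow> \<exists>t\<le>poly c (tsize (enc_in y)). runs Q (enc_in y) t (enc_out (g y))"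
    using assms(1) unfolding poly_time_computable_def by blast
  show ?thesis
  proof (rule ptimeI[of "1 + b + pcompose c b" "Seq P Q"])
    fix x
    obtain s where s: "s \<le> poly b (tsize x)" "runs P x s (enc_in (f x))" using P by blast
    obtain t where t: "t \<le> poly c (tsize (enc_in (f x)))" "runs Q (enc_in (f x)) t (enc_out (g (f x)))"
      using Q[OF assms(3)] by blast
    have "tsize (enc_in (f x)) \<le> poly b (tsize x)"
      using s runs_time_ge_sizes by (meson order_trans)
    then have "t \<le> poly c (poly b (tsize x))" using t(1) poly_nat_mono order_trans by blast
    then show "\<exists>t\<le>poly (1 + b + pcompose c b) (tsize x). runs (Seq P Q) x t (enc_out (g (f x)))"
      using runs.Seq[OF s(2) t(2)] s(1)
      by (intro exI[of _ "1 + s + t"]) (auto simp: poly_pcompose)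
  qed
qed

lemma ptime_comp: "ptime f \<Longrightarrow> ptime g \<Longrightarrow> ptime (\<lambda>x. g (f x))"
  using ptime_compose[of UNIV id id g f] by (simp add: ptime_def)

lemma ptime_left: "ptime f \<Longrightarrow> ptime (\<lambda>x. left (f x))"
  by (rule ptime_comp[where g = left])
    (auto intro!: ptimeI[of "[:0, 1:]" GoLeft] intro: runs.GoLeft)

lemma ptime_right: "ptime f \<Longrightarrow> ptime (\<lambda>x. right (f x))"
  by (rule ptime_comp[where g = right])
    (auto intro!: ptimeI[of "[:0, 1:]" GoRight] intro: runs.GoRight)

lemma ptime_Node:
  assumes "ptime f" "ptime g"
  shows "ptime (\<lambda>x. Node (f x) (g x))"
proof -
  obtain P b where P: "\<And>x. \<exists>t\<le>poly b (tsize x). runs P x t (f x)"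
    using assms(1) by (rule ptimeE) blast
  obtain Q c where Q: "\<And>x. \<exists>t\<le>poly c (tsize x). runs Q x t (g x)"
    using assms(2) by (rule ptimeE) blast
  show ?thesis
  proof (rule ptimeI[of "1 + b + c" "Fork P Q"])
    fix x
    obtain s where s: "s \<le> poly b (tsize x)" "runs P x s (f x)" using P by blast
    obtain t where t: "t \<le> poly c (tsize x)" "runs Q x t (g x)" using Q by blast
    show "\<exists>t\<le>poly (1 + b + c) (tsize x). runs (Fork P Q) x t (Node (f x) (g x))"
      using runs.Fork[OF s(2) t(2)] s(1) t(1) by (intro exI[of _ "1 + s + t"]) auto
  qed
qed

lemma ptime_if_Leaf:
  assumes "ptime h" "ptime f" "ptime g"
  shows "ptime (\<lambda>x. if h x = Leaf then f x else g x)"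
proof -
  obtain B a where B: "\<And>x. \<exists>t\<le>poly a (tsize x). runs B x t (h x)"
    using assms(1) by (rule ptimeE) blast
  obtain P b where P: "\<And>x. \<exists>t\<le>poly b (tsize x). runs P x t (f x)"
    using assms(2) by (rule ptimeE) blast
  obtain Q c where Q: "\<And>x. \<exists>t\<le>poly c (tsize x). runs Q x t (g x)"
    using assms(3) by (rule ptimeE) blast
  show ?thesis
  proof (rule ptimeI[of "1 + a + b + c" "Cond B Q P"])
    fix x
    obtain r where r: "r \<le> poly a (tsize x)" "runs B x r (h x)" using B by blast
    obtain s where s: "s \<le> poly b (tsize x)" "runs P x s (f x)" using P by blast
    obtain t where t: "t \<le> poly c (tsize x)" "runs Q x t (g x)" using Q by blast
    show "\<exists>t\<le>poly (1 + a + b + c) (tsize x).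
      runs (Cond B Q P) x t (if h x = Leaf then f x else g x)"
    proof (cases "h x = Leaf")
      case True
      then show ?thesis
        using runs.CondFalse[of B x r P s "f x" Q] r s by (intro exI[of _ "1 + r + s"]) auto
    next
      case False
      then show ?thesis
        using runs.CondTrue[OF r(2) False t(2)] r t by (intro exI[of _ "1 + r + t"]) auto
    qed
  qed
qed

lemma ptime_if_eq:
  assumes "ptime f" "ptime g" "ptime h" "ptime k"
  shows "ptime (\<lambda>x. if f x = g x then h x else k x)"
proof -
  have "ptime (\<lambda>x. enc_bool (x \<noteq> Leaf \<and> left x = right x))"
    by (rule ptimeI[of "[:3, 1:]" Equal]) (auto intro!: exI[of _ "tsize _ + 3"] runs.Equal)
  from ptime_comp[OF ptime_Node[OF assms(1,2)] this]
  have "ptime (\<lambda>x. enc_bool (f x = g x))" by simp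
  from ptime_if_Leaf[OF this assms(4,3)]
  moreover have "(\<lambda>x. if enc_bool (f x = g x) = Leaf then k x else h x) =
      (\<lambda>x. if f x = g x then h x else k x)"
    by (auto simp: enc_bool_def)
  ultimately show ?thesis by simp
qed

lemmas ptime_intros = ptime_ident ptime_const ptime_left ptime_right ptime_Node ptime_if_eq

lemma ptime_funpow_right: "ptime f \<Longrightarrow> ptime (\<lambda>x. (right ^^ k) (f x))"
  by (induction k) (auto intro: ptime_right)


subsection \<open>Iteration over lists\<close>

text \<open>The inverse of \<open>enc_list\<close>: along its right spine every tree is the code of
  exactly one list, so list functions become total functions on trees.\<close>

primrec tlist :: "tree \<Rightarrow> tree list" where
  "tlist Leaf = []"
| "tlist (Node a b) = a # tlist b"

lemma enc_list_tlist [simp]: "enc_list (tlist t) = t"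
  by (induction t) auto

lemma tlist_enc_list [simp]: "tlist (enc_list xs) = xs"
  by (induction xs) auto

lemma tsize_enc_list: "tsize (enc_list xs) = 1 + (\<Sum>x\<leftarrow>xs. 1 + tsize x)"
  by (induction xs) auto

lemma length_le_tsize_enc_list: "length xs \<le> tsize (enc_list xs)"
  by (induction xs) auto

text \<open>The loop keeps the context \<open>c\<close>, the rest of the list and the accumulator \<open>a\<close> in one
  tree.  Since the accumulator grows by at most \<open>H\<close> in each round, it never exceeds \<open>S\<close>.\<close>

lemma runs_fold_loop:
  fixes b :: "nat poly"
  assumes G: "\<And>z. \<exists>t\<le>poly b (tsize z). runs G z t (g (left z) (left (right z)) (right (right z)))"
    and grow: "\<And>x a. tsize x \<le> N \<Longrightarrow> tsize (g c x a) \<le> tsize a + H"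
    and "tsize c \<le> N" "tsize (enc_list xs) \<le> N" "tsize a + length xs * H \<le> S"
  defines "B \<equiv> Seq GoRight GoLeft"
    and "P \<equiv> Fork GoLeft (Fork (Seq GoRight (Seq GoLeft GoRight))
      (Seq (Fork GoLeft (Fork (Seq GoRight (Seq GoLeft GoLeft)) (Seq GoRight GoRight))) G))"
  shows "\<exists>t\<le>(length xs + 1) * (50 * (2 * N + S + 2) + poly b (2 * N + S + 2)).
    runs (While B P) (Node c (Node (enc_list xs) a)) t (Node c (Node Leaf (fold (g c) xs a)))"
  using assms(3-5)
proof (induction xs arbitrary: a)
  case Nil
  have "runs B (Node c (Node Leaf a)) (1 + tsize (Node c (Node Leaf a)) + tsize (Node Leaf a)) Leaf"
    unfolding B_def
    using runs.Seq[OF runs.GoRight[of "Node c (Node Leaf a)"] runs.GoLeft] by simp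
  from runs.WhileStop[OF this] show ?case using Nil
    by (intro exI[of _ "1 + (1 + tsize (Node c (Node Leaf a)) + tsize (Node Leaf a))"]) auto
next
  case (Cons x xs)
  let ?l = "enc_list xs"
  let ?s = "Node c (Node (Node x ?l) a)"
  let ?T = "50 * (2 * N + S + 2) + poly b (2 * N + S + 2)"
  have sizes: "tsize x \<le> N" "tsize ?l \<le> N" "tsize c \<le> N" "1 + tsize x + tsize ?l \<le> N"
    "tsize a \<le> S"
    using Cons.prems by auto
  have "tsize (g c x a) + length xs * H \<le> S"
    using grow[OF sizes(1), of a] Cons.prems(3) by simp
  from Cons.IH[OF sizes(3,2) this] obtain u where
    u: "u \<le> (length xs + 1) * ?T"
      "runs (While B P) (Node c (Node ?l (g c x a))) u
        (Node c (Node Leaf (fold (g c) xs (g c x a))))" by blast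
  obtain t where t: "t \<le> poly b (tsize (Node c (Node x a)))" "runs G (Node c (Node x a)) t (g c x a)"
    using G[of "Node c (Node x a)"] by auto
  have "tsize (Node c (Node x a)) \<le> 2 * N + S + 2" using sizes by simp
  then have t': "t \<le> poly b (2 * N + S + 2)" using t(1) poly_nat_mono order_trans by blast
  \<comment> \<open>Every loop state has size at most \<open>2 * N + S + 2\<close>. The constants
    are generous: 10 for the test, 39 for moving data in the body, and 1 for the charge of the loop
    itself make 50.\<close>
  have "\<exists>s. s \<le> 10 * (2 * N + S + 2) \<and> runs B ?s s (Node x ?l)"
    unfolding B_def
    by (intro exI conjI, rule_tac[2] runs.Seq[OF runs.GoRight runs.GoLeft, of ?s, simplified])
      (use sizes in auto)
  then obtain s where s: "s \<le> 10 * (2 * N + S + 2)" "runs B ?s s (Node x ?l)" by blast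
  have 1: "runs GoRight ?s (tsize ?s) (Node (Node x ?l) a)"
    using runs.GoRight[of ?s] by simp
  have 2: "runs GoLeft (Node (Node x ?l) a) (tsize (Node (Node x ?l) a)) (Node x ?l)"
    using runs.GoLeft[of "Node (Node x ?l) a"] by simp
  have 3: "runs GoRight (Node x ?l) (tsize (Node x ?l)) ?l"
    using runs.GoRight[of "Node x ?l"] by simp
  have 4: "runs GoLeft (Node x ?l) (tsize (Node x ?l)) x"
    using runs.GoLeft[of "Node x ?l"] by simp
  have 5: "runs GoRight (Node (Node x ?l) a) (tsize (Node (Node x ?l) a)) a"
    using runs.GoRight[of "Node (Node x ?l) a"] by simp
  have 6: "runs GoLeft ?s (tsize ?s) c" using runs.GoLeft[of ?s] by simp
  \<comment> \<open>The body rebuilds the state with the head dropped from the list;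
    \<open>G\<close> receives only the context, the head and the accumulator.\<close>
  note body = runs.Fork[OF 6 runs.Fork[OF runs.Seq[OF 1 runs.Seq[OF 2 3]]
    runs.Seq[OF runs.Fork[OF 6 runs.Fork[OF runs.Seq[OF 1 runs.Seq[OF 2 4]] runs.Seq[OF 1 5]]] t(2)]]]
  have "\<exists>v. v \<le> 39 * (2 * N + S + 2) + poly b (2 * N + S + 2) \<and>
      runs P ?s v (Node c (Node ?l (g c x a)))"
    unfolding P_def by (intro exI conjI, rule_tac[2] body) (use sizes t' in auto)
  then obtain v where v: "v \<le> 39 * (2 * N + S + 2) + poly b (2 * N + S + 2)"
    "runs P ?s v (Node c (Node ?l (g c x a)))" by blast
  have "1 + s + v + u \<le> (length (x # xs) + 1) * ?T" using s(1) v(1) u(1) by simp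
  moreover have "runs (While B P) ?s (1 + s + v + u) (Node c (Node Leaf (fold (g c) xs (g c x a))))"
    using s(2) _ v(2) u(2) by (rule runs.WhileStep) simp
  ultimately show ?case unfolding enc_list.simps fold_simps by blast
qed

text \<open>The growth per round is additive and bounded independently of the accumulator; this
  excludes repeated doubling and keeps all intermediate states polynomial. The context
  \<open>fc x\<close> stays fixed during the loop and supplies the variables that its body refers
  to.\<close>

lemma ptime_fold:
  fixes h :: "nat poly"
  assumes g: "ptime (\<lambda>z. g (left z) (left (right z)) (right (right z)))"
    and grow: "\<And>c x a. tsize (g c x a) \<le> tsize a + poly h (tsize c + tsize x)"
    and "ptime fc" "ptime fl" "ptime fa"
  shows "ptime (\<lambda>x. fold (g (fc x)) (tlist (fl x)) (fa x))"
proof -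
  obtain G b where G: "\<And>z. \<exists>t\<le>poly b (tsize z).
      runs G z t (g (left z) (left (right z)) (right (right z)))"
    using g by (rule ptimeE) blast
  define W where "W = While (Seq GoRight GoLeft) (Fork GoLeft (Fork (Seq GoRight (Seq GoLeft GoRight))
      (Seq (Fork GoLeft (Fork (Seq GoRight (Seq GoLeft GoLeft)) (Seq GoRight GoRight))) G)))"
  let ?X = "[:0, 1:] :: nat poly"
  \<comment> \<open>For input size \<open>n\<close> there are at most \<open>n\<close> rounds, each
    adding at most \<open>h (2 * n)\<close> to an accumulator of initial size at most
    \<open>n\<close>; \<open>T\<close> is then the time bound of the loop with
    \<open>N = n\<close>.\<close>
  define S where "S = ?X + ?X * pcompose h (2 * ?X)"
  define T where "T = (?X + 1) * (50 * (2 * ?X + S + 2) + pcompose b (2 * ?X + S + 2))"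
  have T: "poly T n = (n + 1) * (50 * (2 * n + poly S n + 2) + poly b (2 * n + poly S n + 2))" for n
    by (simp add: T_def poly_pcompose mult_2 mult_2_right algebra_simps)
  have W: "\<exists>t\<le>poly T (tsize (Node c (Node l a))). runs W (Node c (Node l a)) t
      (Node c (Node Leaf (fold (g c) (tlist l) a)))" for c l a
  proof -
    let ?N = "tsize (Node c (Node l a))"
    have "tsize (g c x a) \<le> tsize a + poly h (2 * ?N)" if "tsize x \<le> ?N" for x a
      using grow[of c x a] poly_nat_mono[of "tsize c + tsize x" "2 * ?N" h] that by simp
    moreover have "tsize c \<le> ?N" "tsize (enc_list (tlist l)) \<le> ?N" by simp_all
    moreover have len: "length (tlist l) \<le> ?N"
      using length_le_tsize_enc_list[of "tlist l"] by simp
    then have "tsize a + length (tlist l) * poly h (2 * ?N) \<le> poly S ?N"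
      unfolding S_def
      by (auto simp: poly_pcompose mult.commute[of 2] simp del: tsize.simps(2)
          intro!: add_mono mult_right_mono) simp
    ultimately obtain t where
      t: "t \<le> (length (tlist l) + 1) * (50 * (2 * ?N + poly S ?N + 2) + poly b (2 * ?N + poly S ?N + 2))"
        "runs W (Node c (Node (enc_list (tlist l)) a)) t
          (Node c (Node Leaf (fold (g c) (tlist l) a)))"
      using runs_fold_loop[OF G, of ?N c "poly h (2 * ?N)" "tlist l" a "poly S ?N"]
      unfolding W_def by blast
    moreover have "(length (tlist l) + 1) *
        (50 * (2 * ?N + poly S ?N + 2) + poly b (2 * ?N + poly S ?N + 2)) \<le> poly T ?N"
      unfolding T using len by (intro mult_right_mono) auto
    ultimately have "t \<le> poly T ?N" by linarith
    then show ?thesis using t(2) by auto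
  qed
  let ?loop = "\<lambda>(c, l, a). Node c (Node Leaf (fold (g c) (tlist l) a))"
  have "poly_time_computable UNIV (\<lambda>(c, l, a). Node c (Node l a)) id ?loop"
    unfolding poly_time_computable_def using W by (intro exI[of _ W] exI[of _ T]) auto
  from ptime_compose[OF this, of "\<lambda>x. (fc x, fl x, fa x)"]
  have "ptime (\<lambda>x. ?loop (fc x, fl x, fa x))"
    using assms(3-5) by (simp add: ptime_Node)
  then have "ptime (\<lambda>x. right (right (?loop (fc x, fl x, fa x))))"
    by (intro ptime_right)
  then show ?thesis by simp
qed

section \<open>List operations in polynomial time\<close>

lemma fold_Node: "fold Node xs t = enc_list (rev xs @ tlist t)"
  by (induction xs arbitrary: t) auto

lemma ptime_rev:
  assumes "ptime f"
  shows "ptime (\<lambda>x. enc_list (rev (tlist (f x))))"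
proof -
  have "ptime (\<lambda>x. fold Node (tlist (f x)) Leaf)"
    by (rule ptime_fold[where g = "\<lambda>c. Node" and h = "[:1, 1:]" and fc = "\<lambda>x. x"])
      (auto intro!: ptime_intros assms)
  then show ?thesis by (simp add: fold_Node)
qed

lemma ptime_foldr:
  fixes h :: "nat poly"
  assumes "ptime (\<lambda>z. g (left z) (left (right z)) (right (right z)))"
    and "\<And>c x a. tsize (g c x a) \<le> tsize a + poly h (tsize c + tsize x)"
    and "ptime fc" "ptime fl" "ptime fa"
  shows "ptime (\<lambda>x. foldr (g (fc x)) (tlist (fl x)) (fa x))"
  using ptime_fold[OF assms(1,2,3) ptime_rev[OF assms(4)] assms(5)] by (simp add: foldr_conv_fold)

text \<open>A \<open>foldr\<close> adds one image per round. Its size is polynomial in that of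
  \<open>Node c e\<close>, which accounts for the shift \<open>[:1, 1:]\<close> in the growth
  bound.\<close>

lemma ptime_map:
  assumes g: "ptime (\<lambda>z. g (left z) (right z))" and "ptime fc" "ptime fl"
  shows "ptime (\<lambda>x. enc_list (map (g (fc x)) (tlist (fl x))))"
proof -
  obtain b where b: "\<And>z. tsize (g (left z) (right z)) \<le> poly b (tsize z)"
    using ptime_size_le[OF g] by blast
  have "ptime (\<lambda>x. foldr (\<lambda>e. Node (g (fc x) e)) (tlist (fl x)) Leaf)"
  proof (rule ptime_foldr[where g = "\<lambda>c e. Node (g c e)" and h = "1 + pcompose b [:1, 1:]"])
    show "ptime (\<lambda>z. Node (g (left z) (left (right z))) (right (right z)))"
      using ptime_comp[OF _ g, of "\<lambda>z. Node (left z) (left (right z))"]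
      by (simp add: ptime_intros)
    show "tsize (Node (g c e) a) \<le> tsize a + poly (1 + pcompose b [:1, 1:]) (tsize c + tsize e)"
      for c e a
      using b[of "Node c e"] by (simp add: poly_pcompose)
  qed (auto intro: assms ptime_const)
  moreover have "foldr (\<lambda>e. Node (g c e)) xs Leaf = enc_list (map (g c) xs)" for c xs
    by (induction xs) auto
  ultimately show ?thesis by simp
qed

lemma foldr_Node: "foldr Node xs t = enc_list (xs @ tlist t)"
  by (induction xs) auto

lemma ptime_append:
  assumes "ptime (\<lambda>x. enc_list (f x))" "ptime (\<lambda>x. enc_list (g x))"
  shows "ptime (\<lambda>x. enc_list (f x @ g x))"
proof -
  have "ptime (\<lambda>x. foldr Node (tlist (enc_list (f x))) (enc_list (g x)))"
    by (rule ptime_foldr[where g = "\<lambda>c. Node" and h = "[:1, 1:]" and fc = "\<lambda>x. x"])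
      (auto intro!: ptime_intros assms)
  then show ?thesis by (simp add: foldr_Node)
qed

lemma ptime_concat:
  assumes "ptime (\<lambda>x. enc_list (f x))"
  shows "ptime (\<lambda>x. enc_list (concat (map tlist (f x))))"
proof -
  have "ptime (\<lambda>x. foldr (\<lambda>e a. enc_list (tlist e @ tlist a)) (tlist (enc_list (f x))) Leaf)"
  proof (rule ptime_foldr[where g = "\<lambda>c e a. enc_list (tlist e @ tlist a)" and h = "[:0, 1:]"
        and fc = "\<lambda>x. x"])
    show "ptime (\<lambda>z. enc_list (tlist (left (right z)) @ tlist (right (right z))))"
      by (rule ptime_append) (simp_all add: ptime_intros)
    show "tsize (enc_list (tlist e @ tlist a)) \<le> tsize a + poly [:0, 1:] (tsize c + tsize e)"
      for c e a
      using tsize_enc_list[of "tlist e @ tlist a"] tsize_enc_list[of "tlist e"]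
        tsize_enc_list[of "tlist a"] by simp
  qed (auto intro: assms ptime_intros)
  moreover have "foldr (\<lambda>e a. enc_list (tlist e @ tlist a)) xs Leaf = enc_list (concat (map tlist xs))"
    for xs by (induction xs) auto
  ultimately show ?thesis by simp
qed

lemma ptime_concat_map:
  assumes "ptime (\<lambda>z. enc_list (g (left z) (right z)))" "ptime fc" "ptime fl"
  shows "ptime (\<lambda>x. enc_list (concat (map (g (fc x)) (tlist (fl x)))))"
  using ptime_concat[OF ptime_map[OF assms]] by (simp add: comp_def)

text \<open>The list \<open>Js\<close> is fixed and not computed from the input. Hence each
  \<open>f J\<close> may have its own program, and these finitely many programs are joined by
  \<open>append\<close>.\<close>

lemma ptime_concat_map_const:
  assumes "\<And>J. J \<in> set Js \<Longrightarrow> ptime (\<lambda>x. enc_list (f J x))"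
  shows "ptime (\<lambda>x. enc_list (concat (map (\<lambda>J. f J x) Js)))"
  using assms by (induction Js) (auto intro!: ptime_append ptime_const)

text \<open>Since \<open>k\<close> is a constant, the number of words is polynomial in the length of
  the list. Each induction step is one nested loop that prepends every letter to every shorter
  word.\<close>

lemma ptime_n_lists:
  assumes "ptime f"
  shows "ptime (\<lambda>x. enc_list (map enc_list (List.n_lists k (tlist (f x)))))"
proof (induction k)
  case 0
  show ?case by (simp add: ptime_const)
next
  case (Suc k)
  let ?W = "\<lambda>x. enc_list (map enc_list (List.n_lists k (tlist (f x))))"
  have 1: "ptime (\<lambda>z. enc_list (map (\<lambda>v. Node v (right z)) (tlist (left z))))"
    by (rule ptime_map[where g = "\<lambda>w v. Node v w"]) (auto intro!: ptime_intros)
  have "ptime (\<lambda>x. enc_list (concat (map (\<lambda>w. map (\<lambda>v. Node v w) (tlist (f x))) (tlist (?W x)))))"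
    by (rule ptime_concat_map[where g = "\<lambda>V w. map (\<lambda>v. Node v w) (tlist V)"]) (fact 1 assms Suc)+
  then show ?case by (simp add: map_concat comp_def)
qed

section \<open>Pivot columns\<close>

text \<open>Selects from the second list the element at the place where the first list first differs
  from \<open>z\<close>. Applied to a row of an echelon form and the list of tuples, it yields the
  tuple of the pivot column; for a zero row it yields the empty list, which vanishes under
  \<open>concat\<close>.\<close>

fun leading :: "'a \<Rightarrow> 'a list \<Rightarrow> 'b list \<Rightarrow> 'b list" where
  "leading z (a # as) (b # bs) = (if a = z then leading z as bs else [b])"
| "leading z _ _ = []"

text \<open>Lets the search run on encoded field elements, with the code of 0 in place of 0.\<close>

lemma leading_map: "inj f \<Longrightarrow> leading (f z) (map f as) bs = leading z as bs"
  by (induction z as bs rule: leading.induct) (auto simp: inj_eq)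

text \<open>The value \<open>k = length as\<close> stands for the absence of such an entry, as a
  pivot function marks a zero row by the number of columns.\<close>

lemma leading_eq:
  assumes "length as = length bs" "k \<le> length as" "\<And>i. i < k \<Longrightarrow> as ! i = z"
    "k < length as \<Longrightarrow> as ! k \<noteq> z"
  shows "leading z as bs = (if k < length as then [bs ! k] else [])"
  using assms
proof (induction z as bs arbitrary: k rule: leading.induct)
  case (1 z a as b bs)
  show ?case
  proof (cases k)
    case 0
    then show ?thesis using "1.prems"(4) by simp
  next
    case (Suc k')
    have "a = z" using "1.prems"(3)[of 0] Suc by simp
    moreover have "as ! i = z" if "i < k'" for i using "1.prems"(3)[of "Suc i"] Suc that by simp
    ultimately show ?thesis using "1.IH"[of k'] "1.prems" Suc by simp
  qed
qed auto

text \<open>The accumulator is \<open>Node (result) (unread part of bs)\<close>; an empty unread part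
  stops the search.\<close>

lemma ptime_leading:
  assumes "ptime f" "ptime h"
  shows "ptime (\<lambda>x. enc_list (leading z (tlist (f x)) (tlist (h x))))"
proof -
  define g where "g c e a = (if right a = Leaf then a
    else if e = z then Node Leaf (right (right a)) else Node (Node (left (right a)) Leaf) Leaf)"
    for c e a :: tree
  have "ptime (\<lambda>x. fold (g (f x)) (tlist (f x)) (Node Leaf (h x)))"
  proof (rule ptime_fold[where h = 0])
    show "ptime (\<lambda>z. g (left z) (left (right z)) (right (right z)))"
      unfolding g_def by (intro ptime_intros)
    \<comment> \<open>No growth at all: a round either shortens the unread part or moves its head
      into the result and discards the rest.\<close>
    show "tsize (g c e a) \<le> tsize a + poly 0 (tsize c + tsize e)" for c e a
    proof (cases a)
      case (Node u v)
      then show ?thesis using tsize_pos[of u] tsize_pos[of "right v"]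
        by (cases v) (auto simp: g_def)
    qed (auto simp: g_def)
  qed (auto intro!: ptime_intros assms)
  then have "ptime (\<lambda>x. left (fold (g (f x)) (tlist (f x)) (Node Leaf (h x))))"
    by (rule ptime_left)
  moreover have stop: "fold (g c) as (Node u Leaf) = Node u Leaf" for c as u
    by (induction as) (auto simp: g_def)
  have "left (fold (g c) as (Node Leaf (enc_list bs))) = enc_list (leading z as bs)" for c as bs
  proof (induction as arbitrary: bs)
    case (Cons a as)
    have 1: "g c a (Node Leaf Leaf) = Node Leaf Leaf" by (simp add: g_def)
    have 2: "g c a (Node Leaf (Node b t)) = (if a = z then Node Leaf t else Node (Node b Leaf) Leaf)"
      for b t by (simp add: g_def)
    show ?case by (cases bs) (auto simp: stop 1 2 Cons.IH)
  qed simp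
  then have "left (fold (g c) as (Node Leaf t)) = enc_list (leading z as (tlist t))" for c as t
    by (metis enc_list_tlist)
  ultimately show ?thesis by simp
qed

section \<open>Pivot columns of the reduced row echelon form\<close>

context
  fixes A B :: "'f :: field mat" and nr nc :: nat and piv :: "nat \<Rightarrow> nat"
  assumes A: "A \<in> carrier_mat nr nc" and B: "B = gauss_jordan_single A"
    and piv: "pivot_fun B piv nc"
begin

private lemma carrier_B: "B \<in> carrier_mat nr nc"
  using gauss_jordan_single(2)[OF A] B by simp

private lemmas pivD = pivot_funD[OF carrier_matD(1)[OF carrier_B] piv]

text \<open>A pivot column has a 1 in its own row and 0 in all others, so it cannot serve two
  rows.\<close>

lemma pivots_inj: "inj_on piv {i. i < nr \<and> piv i < nc}"
proof (rule inj_onI)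
  fix i i' assume "i \<in> {i. i < nr \<and> piv i < nc}" "i' \<in> {i. i < nr \<and> piv i < nc}" "piv i = piv i'"
  then show "i = i'" using pivD(4)[of i'] pivD(5)[of i i'] by fastforce
qed

text \<open>Invertible row operations preserve linear relations between columns. In \<open>B\<close>
  the pivot columns are unit vectors, so the coefficients of column \<open>j\<close> are its own
  entries; multiplying by \<open>Q\<close> carries the relation back to \<open>A\<close>.\<close>

lemma column_eq_pivot_columns:
  assumes i: "i < nr" and j: "j < nc"
  shows "A $$ (i, j) = (\<Sum>k | k < nr \<and> piv k < nc. B $$ (k, j) * A $$ (i, piv k))"
proof -
  obtain P Q where PQ: "B = P * A" "P \<in> carrier_mat nr nr" "Q \<in> carrier_mat nr nr" "Q * P = 1\<^sub>m nr"
    using gauss_jordan_single(4)[OF A B[symmetric]] by blast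
  have "Q * B = A"
    using PQ A by (simp flip: assoc_mult_mat)
  then have entry: "A $$ (i, c) = (\<Sum>s<nr. Q $$ (i, s) * B $$ (s, c))" if "c < nc" for c
    using PQ(3) carrier_B i that
    by (metis (no_types, lifting) carrier_matD index_mult_mat(1) scalar_prod_def index_row(1)
        atLeast0LessThan dim_col index_col lessThan_iff sum.cong)
  have B_entry: "B $$ (s, j) = (\<Sum>k | k < nr \<and> piv k < nc. B $$ (k, j) * B $$ (s, piv k))"
    if s: "s < nr" for s
  proof -
    have "(\<Sum>k | k < nr \<and> piv k < nc. B $$ (k, j) * B $$ (s, piv k)) =
      (\<Sum>k | k < nr \<and> piv k < nc. if k = s then B $$ (s, j) else 0)"
      using s by (intro sum.cong) (auto simp: pivD(4) pivD(5))
    also have "\<dots> = (if piv s < nc then B $$ (s, j) else 0)"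
      using s by (subst sum.delta) auto
    \<comment> \<open>If \<open>piv s = nc\<close>, row \<open>s\<close> is zero and both sides
      vanish.\<close>
    also have "\<dots> = B $$ (s, j)"
      using pivD(1)[OF s] pivD(2)[OF s, of j] j by auto
    finally show ?thesis by simp
  qed
  have "A $$ (i, j) = (\<Sum>s<nr. Q $$ (i, s) * (\<Sum>k | k < nr \<and> piv k < nc. B $$ (k, j) * B $$ (s, piv k)))"
    unfolding entry[OF j] using B_entry by (intro sum.cong) auto
  also have "\<dots> = (\<Sum>k | k < nr \<and> piv k < nc. B $$ (k, j) * (\<Sum>s<nr. Q $$ (i, s) * B $$ (s, piv k)))"
    unfolding sum_distrib_left by (subst sum.swap) (simp add: mult.left_commute)
  also have "\<dots> = (\<Sum>k | k < nr \<and> piv k < nc. B $$ (k, j) * A $$ (i, piv k))"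
    using entry by (intro sum.cong) auto
  finally show ?thesis .
qed

text \<open>Connects the list that the machine produces with the pivot function: each nonzero row
  contributes the element at its pivot.\<close>

lemma leading_rows:
  assumes "length xs = nc"
  shows "concat (map (\<lambda>row. leading 0 row xs) (mat_to_list B)) =
    map (\<lambda>k. xs ! piv k) (filter (\<lambda>k. piv k < nc) [0..<nr])"
proof -
  have row: "leading 0 (map (\<lambda>j. B $$ (i, j)) [0..<nc]) xs = (if piv i < nc then [xs ! piv i] else [])"
    if i: "i < nr" for i
    using pivD(1,2,4)[OF i] assms by (subst leading_eq[where k = "piv i"]) auto
  have filter: "concat (map (\<lambda>k. if Q k then [h k] else []) ks) = map h (filter Q ks)"
    for Q h and ks :: "nat list"
    by (induction ks) auto
  have "map (\<lambda>row. leading 0 row xs) (mat_to_list B) =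
      map (\<lambda>i. if piv i < nc then [xs ! piv i] else []) [0..<nr]"
    using carrier_B row by (auto simp: mat_to_list_def)
  then show ?thesis by (simp add: filter)
qed

end


section \<open>Polynomials of bounded degree as linear functionals\<close>

text \<open>Every linear relation between the 0/1 vectors of the tuples is inherited by the values of
  the polynomial; \<open>u\<close> and \<open>U k\<close> give the vertices of a tuple by position.\<close>

lemma mpoly_eval_linear_relation:
  fixes p :: "(nat \<times> nat, 'f :: field) mpoly" and u :: "nat \<Rightarrow> 'v" and U :: "'k \<Rightarrow> nat \<Rightarrow> 'v"
    and g :: "'v \<Rightarrow> nat \<Rightarrow> 'f"
  assumes p: "matrix_poly nr N p" "mpoly_degree p \<le> r" and N: "N \<ge> 1"
    and V: "finite V" "u ` {..<N} \<subseteq> V" "\<And>k. k \<in> K \<Longrightarrow> U k ` {..<N} \<subseteq> V"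
    and rel: "\<And>J w. length J = r \<Longrightarrow> set J \<subseteq> {..<N} \<Longrightarrow> length w = r \<Longrightarrow> set w \<subseteq> V \<Longrightarrow>
      of_bool (map u J = w) = (\<Sum>k\<in>K. a k * of_bool (map (U k) J = w))"
  shows "mpoly_eval p (\<lambda>(i, j). g (u j) i) = (\<Sum>k\<in>K. a k * mpoly_eval p (\<lambda>(i, j). g (U k j) i))"
proof -
  let ?W = "{w. set w \<subseteq> V \<and> length w = r}"
  have fin: "finite ?W" by (rule finite_lists_length_eq[OF V(1)])
  \<comment> \<open>The indicators of single words span all functions on the finite set
    \<open>?W\<close>, so the relation passes from them to every \<open>h\<close>.\<close>
  have functional: "h (map u J) = (\<Sum>k\<in>K. a k * h (map (U k) J))"
    if J: "length J = r" "set J \<subseteq> {..<N}" for J and h :: "'v list \<Rightarrow> 'f"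
  proof -
    have pick: "h y = (\<Sum>w\<in>?W. of_bool (y = w) * h w)" if "y \<in> ?W" for y
    proof -
      have "(\<Sum>w\<in>?W. of_bool (y = w) * h w) = (\<Sum>w\<in>?W. if y = w then h w else 0)"
        by (intro sum.cong) auto
      then show ?thesis using that fin by simp
    qed
    have "map u J \<in> ?W" using J V(2) by auto
    then have "h (map u J) = (\<Sum>w\<in>?W. of_bool (map u J = w) * h w)" by (rule pick)
    also have "\<dots> = (\<Sum>w\<in>?W. (\<Sum>k\<in>K. a k * of_bool (map (U k) J = w)) * h w)"
      using rel[OF J] by (intro sum.cong) auto
    also have "\<dots> = (\<Sum>k\<in>K. a k * (\<Sum>w\<in>?W. of_bool (map (U k) J = w) * h w))"
      unfolding sum_distrib_left sum_distrib_right by (subst sum.swap) (simp add: mult.assoc)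
    also have "\<dots> = (\<Sum>k\<in>K. a k * h (map (U k) J))"
    proof (intro sum.cong refl arg_cong2[where f = "(*)"])
      fix k assume "k \<in> K"
      then have "map (U k) J \<in> ?W" using J V(3)[of k] by auto
      then show "(\<Sum>w\<in>?W. of_bool (map (U k) J = w) * h w) = h (map (U k) J)"
        by (rule pick[symmetric])
    qed
    finally show ?thesis .
  qed
  let ?mon = "\<lambda>\<mu> u. \<Prod>v\<in>Poly_Mapping.keys \<mu>. (case v of (i, j) \<Rightarrow> g (u j) i) ^ Poly_Mapping.lookup \<mu> v"
  have mon: "?mon \<mu> u = (\<Sum>k\<in>K. a k * ?mon \<mu> (U k))" if \<mu>: "\<mu> \<in> Poly_Mapping.keys p" for \<mu>
  proof -
    let ?S = "snd ` Poly_Mapping.keys \<mu>"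
    \<comment> \<open>Every variable in the monomial has exponent at least 1, so at most
      \<open>r\<close> variables, and hence at most \<open>r\<close> columns, occur.\<close>
    have "card ?S \<le> card (Poly_Mapping.keys \<mu>)" by (intro card_image_le) simp
    also have "\<dots> \<le> (\<Sum>v\<in>Poly_Mapping.keys \<mu>. Poly_Mapping.lookup \<mu> v)"
    proof -
      have "1 \<le> Poly_Mapping.lookup \<mu> v" if "v \<in> Poly_Mapping.keys \<mu>" for v
        using that by (simp add: in_keys_iff Suc_le_eq)
      from sum_mono[OF this, of "Poly_Mapping.keys \<mu>"] show ?thesis by simp
    qed
    also have "\<dots> \<le> mpoly_degree p"
      unfolding mpoly_degree_def using \<mu> by (intro Max_ge) auto
    finally have card: "card ?S \<le> r" using p(2) by simp
    \<comment> \<open>The columns of the monomial, padded to length exactly \<open>r\<close>. The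
      padding 0 is a legal position because \<open>N\<close> is at least 1.\<close>
    define J where "J = sorted_list_of_set ?S @ replicate (r - card ?S) 0"
    have S: "?S \<subseteq> {..<N}" using p(1) \<mu> by (fastforce simp: matrix_poly_def mpoly_vars_def)
    have J: "length J = r" "set J \<subseteq> {..<N}" "?S \<subseteq> set J"
      using card S N by (auto simp: J_def)
    \<comment> \<open>Padding may repeat the position 0, so some occurrence of \<open>j\<close> in
      \<open>J\<close> is chosen. Through it the monomial becomes a function \<open>h\<close> of the
      word at \<open>J\<close>.\<close>
    define pos where "pos j = (SOME n. n < length J \<and> J ! n = j)" for j
    have pos: "pos j < length J" "J ! pos j = j" if "j \<in> ?S" for j
    proof -
      have "\<exists>n. n < length J \<and> J ! n = j" using that J(3) by (metis in_set_conv_nth subsetD)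
      from someI_ex[OF this] show "pos j < length J" "J ! pos j = j" by (simp_all add: pos_def)
    qed
    define h where "h w = ?mon \<mu> (\<lambda>j. w ! pos j)" for w
    have "h (map y J) = ?mon \<mu> y" for y
      unfolding h_def
    proof (intro prod.cong refl)
      fix v assume "v \<in> Poly_Mapping.keys \<mu>"
      then have "snd v \<in> ?S" by simp
      from pos[OF this] show "(case v of (i, j) \<Rightarrow> g (map y J ! pos j) i) ^ Poly_Mapping.lookup \<mu> v =
          (case v of (i, j) \<Rightarrow> g (y j) i) ^ Poly_Mapping.lookup \<mu> v"
        by (simp add: case_prod_beta)
    qed
    then show ?thesis using functional[OF J(1,2), of h] by simp
  qed
  have "mpoly_eval p (\<lambda>(i, j). g (u j) i) =
      (\<Sum>\<mu>\<in>Poly_Mapping.keys p. Poly_Mapping.lookup p \<mu> * (\<Sum>k\<in>K. a k * ?mon \<mu> (U k)))"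
    unfolding mpoly_eval_def using mon by (intro sum.cong) auto
  also have "\<dots> = (\<Sum>k\<in>K. a k * mpoly_eval p (\<lambda>(i, j). g (U k j) i))"
    unfolding mpoly_eval_def sum_distrib_left by (subst sum.swap) (simp add: mult.left_commute)
  finally show ?thesis .
qed

lemma mpoly_eval_cong:
  assumes "\<And>v. v \<in> mpoly_vars p \<Longrightarrow> x v = y v"
  shows "mpoly_eval p x = mpoly_eval p y"
  unfolding mpoly_eval_def
  by (intro sum.cong prod.cong arg_cong2[where f = "(*)"] refl arg_cong2[where f = "(^)"] assms)
    (auto simp: mpoly_vars_def)

section \<open>The kernel\<close>

definition indicator_mat :: "'a list \<Rightarrow> 'b list \<Rightarrow> ('a \<Rightarrow> 'b \<Rightarrow> bool) \<Rightarrow> 'f :: field mat" where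
  "indicator_mat as bs R = mat (length as) (length bs) (\<lambda>(i, j). of_bool (R (as ! i) (bs ! j)))"

lemma mat_to_list_indicator_mat:
  "mat_to_list (indicator_mat as bs R) = map (\<lambda>a. map (\<lambda>b. of_bool (R a b)) bs) as"
  by (auto simp: mat_to_list_def indicator_mat_def intro!: nth_equalityI)

text \<open>Place \<open>k mod d\<close> in block \<open>k div d\<close>, which matches the column
  blocks of width \<open>d\<close>. The order within a set is the one given by its encoding.\<close>

definition position :: "nat \<Rightarrow> tree \<Rightarrow> nat \<Rightarrow> tree" where
  "position d T k = left ((right ^^ (k mod d)) (left ((right ^^ (k div d)) T)))"

definition row_keys :: "nat \<Rightarrow> nat \<Rightarrow> tree list \<Rightarrow> (nat list \<times> tree list) list" where
  "row_keys r N V = List.product (List.n_lists r [0..<N]) (List.n_lists r V)"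

definition incidence_mat :: "nat \<Rightarrow> nat \<Rightarrow> nat \<Rightarrow> tree \<Rightarrow> 'f :: field mat" where
  "incidence_mat d l r x = indicator_mat (row_keys r (d * l) (tlist (left x)))
     (tlist (right (right x))) (\<lambda>(J, w) T. map (position d T) J = w)"

text \<open>Vertices and edges are copied unchanged, and the retained tuples keep their original
  codes. The field enters only through the intermediate matrix, hence the type argument.\<close>

definition kernel :: "'f :: field itself \<Rightarrow> nat \<Rightarrow> nat \<Rightarrow> nat \<Rightarrow> tree \<Rightarrow> tree" where
  "kernel _ d l r x = Node (left x) (Node (left (right x))
     (enc_list (concat (map (\<lambda>row. leading 0 row (tlist (right (right x))))
       (mat_to_list (gauss_jordan_single (incidence_mat d l r x :: 'f mat)))))))"

section \<open>Running time of the kernel\<close>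

lemma ptime_position: "ptime f \<Longrightarrow> ptime (\<lambda>x. position d (f x) k)"
  unfolding position_def by (intro ptime_left ptime_funpow_right)

text \<open>The position lists form a constant list, so the rows are produced by a fixed number of
  loops over the words of \<open>r\<close> vertices. Only the two constants \<open>enc 0\<close> and
  \<open>enc 1\<close> are ever written.\<close>

lemma ptime_incidence_mat:
  fixes enc :: "'f :: field \<Rightarrow> tree"
  shows "ptime (\<lambda>x. enc_mat enc (incidence_mat d l r x))"
proof -
  define entry where "entry J w T = (if enc_list (map (position d T) J) = w then enc 1 else enc 0)"
    for J w T
  let ?rows = "\<lambda>J x. map (\<lambda>w. enc_list (map (entry J w) (tlist (right (right x)))))
    (tlist (enc_list (map enc_list (List.n_lists r (tlist (left x))))))"
  have positions: "ptime (\<lambda>z. enc_list (map (position d (right z)) J))" for J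
    by (induction J) (auto intro!: ptime_intros ptime_position)
  have entry: "ptime (\<lambda>z. entry J (left z) (right z))" for J
    unfolding entry_def by (intro ptime_intros positions)
  have row: "ptime (\<lambda>z. enc_list (map (entry J (right z)) (tlist (left z))))" for J
    by (rule ptime_map[OF entry]) (intro ptime_intros)+
  have "ptime (\<lambda>x. enc_list (?rows J x))" for J
    by (rule ptime_map[where g = "\<lambda>c w. enc_list (map (entry J w) (tlist c))"])
      (intro row ptime_n_lists ptime_intros)+
  then have "ptime (\<lambda>x. enc_list (concat (map (\<lambda>J. ?rows J x) (List.n_lists r [0..<d * l]))))"
    by (rule ptime_concat_map_const)
  moreover have "enc_mat enc (incidence_mat d l r x) =
      enc_list (concat (map (\<lambda>J. ?rows J x) (List.n_lists r [0..<d * l])))" for x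
  proof -
    have "entry J (enc_list w) = (\<lambda>T. if map (position d T) J = w then enc 1 else enc 0)" for J w
      using enc_list_inject by (auto simp: entry_def)
    then show ?thesis
      unfolding enc_mat_def incidence_mat_def mat_to_list_indicator_mat row_keys_def product_concat_map
      by (simp add: map_concat comp_def of_bool_def if_distrib[of enc] cong: if_cong)
  qed
  ultimately show ?thesis by simp
qed

text \<open>Write the matrix, eliminate once, and scan each row for its first nonzero entry.
  Comparing with \<open>enc 0\<close> is a sound zero test because \<open>enc\<close> is
  injective.\<close>

lemma ptime_kernel:
  assumes "efficient_field TYPE('f :: field)"
  shows "ptime (kernel TYPE('f) d l r)"
proof -
  obtain enc :: "'f \<Rightarrow> tree" where inj: "inj enc" and
    gauss: "poly_time_computable UNIV (enc_mat enc) (enc_mat enc) gauss_jordan_single"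
    using assms unfolding efficient_field_def by blast
  let ?B = "\<lambda>x. enc_mat enc (gauss_jordan_single (incidence_mat d l r x))"
  have "ptime ?B"
    by (rule ptime_compose[OF gauss ptime_incidence_mat]) simp
  moreover have "ptime (\<lambda>z. enc_list (leading (enc 0) (tlist (right z)) (tlist (left z))))"
    by (intro ptime_leading ptime_intros)
  ultimately have "ptime (\<lambda>x. enc_list (concat
      (map (\<lambda>row. leading (enc 0) (tlist row) (tlist (right (right x)))) (tlist (?B x)))))"
    by (intro ptime_concat_map[where g = "\<lambda>c row. leading (enc 0) (tlist row) (tlist c)"]
        ptime_intros)
  then have "ptime (\<lambda>x. Node (left x) (Node (left (right x)) (enc_list (concat
      (map (\<lambda>row. leading (enc 0) (tlist row) (tlist (right (right x)))) (tlist (?B x)))))))"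
    by (intro ptime_intros)
  then show ?thesis
    unfolding kernel_def enc_mat_def by (simp add: comp_def leading_map[OF inj])
qed

section \<open>From encoded tuples to colored matrices\<close>

lemma funpow_right_enc_list: "(right ^^ n) (enc_list xs) = enc_list (drop n xs)"
proof (induction n)
  case (Suc n)
  have "right (enc_list ys) = enc_list (tl ys)" for ys by (cases ys) auto
  then show ?case using Suc by (simp add: tl_drop drop_Suc)
qed simp

lemma left_funpow_right_enc_list: "n < length xs \<Longrightarrow> left ((right ^^ n) (enc_list xs)) = xs ! n"
  by (simp add: funpow_right_enc_list flip: Cons_nth_drop_Suc)

lemma encodes_set_vertex_iff:
  "encodes_set encodes_vertex S t \<longleftrightarrow> (\<exists>us. distinct us \<and> set us = S \<and> t = enc_list (map enc_nat us))"
proof -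
  have "list_all2 encodes_vertex us ts \<longleftrightarrow> ts = map enc_nat us" for us ts
    by (auto simp: list_all2_conv_all_nth encodes_vertex_def intro!: nth_equalityI)
  then show ?thesis by (auto simp: encodes_set_def encodes_list_def)
qed

lemma block_of_position:
  fixes k d l :: nat
  assumes "k < d * l"
  shows "k div d < l" "k \<in> {k div d * d..<(k div d + 1) * d}"
proof -
  have "d > 0" using assms by (cases d) auto
  then show "k div d < l" "k \<in> {k div d * d..<(k div d + 1) * d}"
    using assms dividend_less_div_times[of d k]
    by (auto simp: less_mult_imp_div_less mult.commute add.commute)
qed

text \<open>A set of size \<open>d\<close> is listed without repetition, so its list has length
  exactly \<open>d\<close> and addressing by \<open>div\<close> and \<open>mod\<close> reaches every
  element.\<close>

lemma encoded_tuple_positions: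
  assumes enc: "encodes_list (encodes_set encodes_vertex) F T" and "\<And>S. S \<in> set F \<Longrightarrow> card S = d"
  obtains u where "\<And>k. k < d * length F \<Longrightarrow> position d T k = enc_nat (u k)"
    and "\<And>j. j < length F \<Longrightarrow> u ` {j * d..<(j + 1) * d} = F ! j"
proof -
  obtain ts where ts: "list_all2 (encodes_set encodes_vertex) F ts" "T = enc_list ts"
    using enc by (auto simp: encodes_list_def)
  have "\<forall>j<length F. \<exists>us. distinct us \<and> set us = F ! j \<and> ts ! j = enc_list (map enc_nat us)"
    using ts(1) by (auto simp: list_all2_conv_all_nth encodes_set_vertex_iff)
  then obtain us where us: "\<And>j. j < length F \<Longrightarrow>
      distinct (us j) \<and> set (us j) = F ! j \<and> ts ! j = enc_list (map enc_nat (us j))"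
    by metis
  have len: "length (us j) = d" if "j < length F" for j
    using us[OF that] assms(2)[OF nth_mem[OF that]] distinct_card by metis
  define u where "u k = us (k div d) ! (k mod d)" for k
  show thesis
  proof (rule that[of u])
    fix k assume k: "k < d * length F"
    then have j: "k div d < length F" "k mod d < d"
      using block_of_position(1)[OF k] by (cases d; simp)+
    then show "position d T k = enc_nat (u k)"
      using us[OF j(1)] len[OF j(1)] list_all2_lengthD[OF ts(1)] ts(2)
      by (simp add: position_def u_def left_funpow_right_enc_list)
  next
    fix j assume j: "j < length F"
    have "u ` {j * d..<(j + 1) * d} = (\<lambda>i. us j ! i) ` {..<d}"
    proof -
      have "{j * d..<(j + 1) * d} = (\<lambda>i. j * d + i) ` {..<d}"
        by (simp add: lessThan_atLeast0 add.commute)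
      moreover have "u (j * d + i) = us j ! i" if "i < d" for i
        using that by (simp add: u_def)
      ultimately show ?thesis by (simp add: image_image)
    qed
    also have "\<dots> = set (us j)" using len[OF j] by (auto simp: set_conv_nth)
    finally show "u ` {j * d..<(j + 1) * d} = F ! j" using us[OF j] by simp
  qed
qed

text \<open>Take the matrix whose column \<open>k\<close> is the vector in \<open>C\<close> for the
  color of the vertex at position \<open>k\<close>. Its blocks are the color sets mapped by
  \<open>\<beta>\<close>, and injectivity of \<open>\<beta>\<close> preserves both their equality
  and their sizes.\<close>

lemma uniformly_rainbow_iff_mpoly_eval:
  fixes p :: "(nat \<times> nat, 'f :: field) mpoly"
  assumes C: "C \<subseteq> carrier_vec m" and p: "matrix_poly m (d * l) p"
    and cap: "captures_uniformly_rainbow m d l q C p"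
    and \<beta>: "bij_betw \<beta> {1..q} C"
    and c: "\<And>S. S \<in> set F \<Longrightarrow> c ` S \<subseteq> {1..q}" and "length F = l"
    and u: "\<And>j. j < l \<Longrightarrow> u ` {j * d..<(j + 1) * d} = F ! j"
  shows "uniformly_rainbow d c F \<longleftrightarrow> mpoly_eval p (\<lambda>(i, k). \<beta> (c (u k)) $ i) \<noteq> 0"
proof -
  define M where "M = mat m (d * l) (\<lambda>(i, k). \<beta> (c (u k)) $ i)"
  have uC: "\<beta> (c (u k)) \<in> C" if "k < d * l" for k
  proof -
    have "u k \<in> F ! (k div d)" "F ! (k div d) \<in> set F"
      using block_of_position[OF that] u \<open>length F = l\<close> by (blast, simp)
    then show ?thesis using c \<beta> by (meson bij_betw_apply imageI subsetD)
  qed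
  have col: "col M k = \<beta> (c (u k))" if "k < d * l" for k
  proof -
    have "dim_vec (\<beta> (c (u k))) = m" using uC[OF that] C by (blast dest: carrier_vecD)
    then show ?thesis using that by (intro eq_vecI) (auto simp: M_def)
  qed
  have block: "column_block d M j = \<beta> ` c ` (F ! j)" if j: "j < l" for j
  proof -
    have "k < d * l" if "k < (j + 1) * d" for k
    proof -
      have "(j + 1) * d \<le> l * d" using j by (intro mult_right_mono) auto
      then show ?thesis using that by (simp add: mult.commute)
    qed
    then have "col M k = \<beta> (c (u k))" if "k \<in> {j * d..<(j + 1) * d}" for k
      using that by (intro col) simp
    then have "col M ` {j * d..<(j + 1) * d} = (\<lambda>k. \<beta> (c (u k))) ` {j * d..<(j + 1) * d}"
      by (rule image_cong[OF refl])
    moreover have "column_block d M j = col M ` {j * d..<(j + 1) * d}"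
      unfolding column_block_def by auto
    ultimately have "column_block d M j = (\<lambda>k. \<beta> (c (u k))) ` {j * d..<(j + 1) * d}" by simp
    also have "\<dots> = \<beta> ` c ` u ` {j * d..<(j + 1) * d}" by (simp only: image_image)
    finally show ?thesis using u[OF j] by simp
  qed
  have inj: "inj_on \<beta> {1..q}" using \<beta> by (rule bij_betw_imp_inj_on)
  have "colored_mat C M" using uC col by (simp add: colored_mat_def M_def)
  moreover have "M \<in> carrier_mat m (d * l)" by (simp add: M_def)
  ultimately have "mpoly_eval p (\<lambda>ij. M $$ ij) \<noteq> 0 \<longleftrightarrow>
      (\<forall>j<l. \<forall>k<l. column_block d M j = column_block d M k) \<and> (\<forall>j<l. card (column_block d M j) = d)"
    using cap unfolding captures_uniformly_rainbow_def by blast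
  also have "mpoly_eval p (\<lambda>ij. M $$ ij) = mpoly_eval p (\<lambda>(i, k). \<beta> (c (u k)) $ i)"
    \<comment> \<open>Matrix entries are specified only inside the index range, and all variables of
      \<open>p\<close> lie there.\<close>
    using p by (intro mpoly_eval_cong) (auto simp: matrix_poly_def M_def)
  also have "(\<forall>j<l. \<forall>k<l. column_block d M j = column_block d M k) \<longleftrightarrow>
      (\<forall>j<l. \<forall>k<l. c ` (F ! j) = c ` (F ! k))"
  proof -
    have "\<beta> ` c ` (F ! j) = \<beta> ` c ` (F ! k) \<longleftrightarrow> c ` (F ! j) = c ` (F ! k)" if "j < l" "k < l" for j k
      using that \<open>length F = l\<close> by (intro inj_on_image_eq_iff[OF inj] c) simp_all
    then show ?thesis by (simp add: block)
  qed
  also have "(\<forall>j<l. card (column_block d M j) = d) \<longleftrightarrow> (\<forall>j<l. card (c ` (F ! j)) = d)"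
  proof -
    have "card (\<beta> ` c ` (F ! j)) = card (c ` (F ! j))" if "j < l" for j
      using that \<open>length F = l\<close> by (intro card_image inj_on_subset[OF inj] c) simp
    then show ?thesis by (simp add: block)
  qed
  finally show ?thesis
    unfolding uniformly_rainbow_def all_set_conv_all_nth \<open>length F = l\<close> by blast
qed

section \<open>Size and correctness of the kernel\<close>

lemma kernel_correct:
  fixes C :: "'f :: field vec set" and p :: "(nat \<times> nat, 'f) mpoly"
  assumes "d \<ge> 1" "l \<ge> 1" and C: "C \<subseteq> carrier_vec m" "card C = q" "finite C"
    and p: "matrix_poly m (d * l) p" "mpoly_degree p \<le> r"
    and cap: "captures_uniformly_rainbow m d l q C p"
    and inst: "urfc_instance d l I" and enc: "encodes_urfc I x"
  shows "\<exists>F' \<subseteq> tuples I. encodes_urfc (I\<lparr>tuples := F'\<rparr>) (kernel TYPE('f) d l r x) \<and>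
    urfc_solutions d q (I\<lparr>tuples := F'\<rparr>) = urfc_solutions d q I \<and>
    card F' \<le> (d * l) ^ r * card (vertices I) ^ r"
proof -
  obtain tV tE tF where x: "x = Node tV (Node tE tF)"
    and tV: "encodes_set encodes_vertex (vertices I) tV"
    and tE: "encodes_set (encodes_set encodes_vertex) (edges I) tE"
    and tF: "encodes_set (encodes_list (encodes_set encodes_vertex)) (tuples I) tF"
    using enc unfolding encodes_urfc_def by blast
  obtain vs where vs: "distinct vs" "set vs = vertices I" "tV = enc_list (map enc_nat vs)"
    using tV by (auto simp: encodes_set_vertex_iff)
  obtain xs ts where xs: "distinct xs" "set xs = tuples I" and ts: "tF = enc_list ts"
    and all2: "list_all2 (encodes_list (encodes_set encodes_vertex)) xs ts"
    using tF by (auto simp: encodes_set_def encodes_list_def)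
  have tuple: "length F = l \<and> (\<forall>S\<in>set F. S \<subseteq> vertices I \<and> card S = d)" if "F \<in> tuples I" for F
    using inst that unfolding urfc_instance_def by blast
  define keys where "keys = row_keys r (d * l) (map enc_nat vs)"
  define nr where "nr = length keys"
  define nc where "nc = length ts"
  define A :: "'f mat" where "A = incidence_mat d l r x"
  define B where "B = gauss_jordan_single A"
  have len_xs: "length xs = nc" using all2 by (simp add: list_all2_lengthD nc_def)
  have mem: "xs ! j \<in> tuples I" if "j < nc" for j
    using that nth_mem[of j xs] xs(2) len_xs by simp
  have nr: "nr = (d * l) ^ r * card (vertices I) ^ r"
    using vs distinct_card[OF vs(1)] by (simp add: nr_def keys_def row_keys_def length_n_lists)
  have A_eq: "A = indicator_mat keys ts (\<lambda>(J, w) T. map (position d T) J = w)"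
    by (simp add: A_def incidence_mat_def x vs(3) ts keys_def)
  have A: "A \<in> carrier_mat nr nc"
    by (simp add: A_eq indicator_mat_def nr_def nc_def)
  obtain piv where piv: "pivot_fun B piv nc"
    using gauss_jordan_single(2,3)[OF A B_def[symmetric]] unfolding row_echelon_form_def by auto
  define K where "K = {k. k < nr \<and> piv k < nc}"
  define ks where "ks = filter (\<lambda>k. piv k < nc) [0..<nr]"
  have ks: "set ks = K" "distinct ks" by (auto simp: ks_def K_def)
  have inj: "inj_on piv K" using pivots_inj[OF A B_def piv] by (simp add: K_def)
  define F' where "F' = (\<lambda>k. xs ! piv k) ` K"
  have sub: "F' \<subseteq> tuples I" using mem by (auto simp: F'_def K_def)

  \<comment> \<open>There is at most one pivot per row, so the number of rows bounds the number of
    retained tuples.\<close>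
  have "card F' \<le> card K" unfolding F'_def by (intro card_image_le) (simp add: K_def)
  also have "\<dots> \<le> card {..<nr}" by (intro card_mono) (auto simp: K_def)
  finally have card: "card F' \<le> (d * l) ^ r * card (vertices I) ^ r" by (simp add: nr)

  have kernel: "kernel TYPE('f) d l r x = Node tV (Node tE (enc_list (map (\<lambda>k. ts ! piv k) ks)))"
    unfolding kernel_def A_def[symmetric] B_def[symmetric]
    using leading_rows[OF A B_def piv, of ts] by (simp add: x ts nc_def ks_def)
  \<comment> \<open>An encoding of a set must not repeat elements: distinct rows have distinct
    pivots, and \<open>xs\<close> is distinct.\<close>
  have "inj_on (\<lambda>k. xs ! piv k) K"
    using inj xs(1) len_xs by (auto simp: inj_on_def K_def nth_eq_iff_index_eq)
  then have "distinct (map (\<lambda>k. xs ! piv k) ks)" by (simp add: distinct_map ks)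
  moreover have "set (map (\<lambda>k. xs ! piv k) ks) = F'" by (simp add: F'_def ks)
  moreover have "list_all2 (encodes_list (encodes_set encodes_vertex))
      (map (\<lambda>k. xs ! piv k) ks) (map (\<lambda>k. ts ! piv k) ks)"
    using all2 ks(1) len_xs by (auto simp: list_all2_conv_all_nth K_def)
  ultimately have "encodes_set (encodes_list (encodes_set encodes_vertex)) F'
      (enc_list (map (\<lambda>k. ts ! piv k) ks))"
    unfolding encodes_set_def encodes_list_def by blast
  then have encodes: "encodes_urfc (I\<lparr>tuples := F'\<rparr>) (kernel TYPE('f) d l r x)"
    unfolding encodes_urfc_def kernel using tV tE by simp

  have "\<exists>u. (\<forall>k<d * l. position d (ts ! j) k = enc_nat (u k)) \<and>
      (\<forall>i<l. u ` {i * d..<(i + 1) * d} = xs ! j ! i)" if j: "j < nc" for j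
  proof -
    have "encodes_list (encodes_set encodes_vertex) (xs ! j) (ts ! j)"
      using all2 j len_xs by (simp add: list_all2_nthD)
    then show ?thesis
      using encoded_tuple_positions[of "xs ! j" "ts ! j" d] tuple[OF mem[OF j]] by metis
  qed
  then obtain u where u: "\<And>j k. j < nc \<Longrightarrow> k < d * l \<Longrightarrow> position d (ts ! j) k = enc_nat (u j k)"
    and blocks: "\<And>j i. j < nc \<Longrightarrow> i < l \<Longrightarrow> u j ` {i * d..<(i + 1) * d} = xs ! j ! i"
    by metis
  have u_V: "u j ` {..<d * l} \<subseteq> vertices I" if j: "j < nc" for j
  proof
    fix v assume "v \<in> u j ` {..<d * l}"
    then obtain k where k: "k < d * l" "v = u j k" by blast
    have "v \<in> xs ! j ! (k div d)"
      using block_of_position[OF k(1)] blocks[OF j] k(2) by blast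
    then show "v \<in> vertices I"
      using tuple[OF mem[OF j]] block_of_position(1)[OF k(1)] by (metis nth_mem subsetD)
  qed
  obtain \<beta> where \<beta>: "bij_betw \<beta> {1..q} C"
    using C(2,3) by (metis card_atLeastAtMost diff_Suc_1 finite_atLeastAtMost finite_same_card_bij)

  have "\<not> uniformly_rainbow d c F"
    if c: "c \<in> vertices I \<rightarrow>\<^sub>E {1..q}" and avoid: "\<forall>F\<in>F'. \<not> uniformly_rainbow d c F"
      and F: "F \<in> tuples I" for c F
  proof -
    have rainbow: "uniformly_rainbow d c (xs ! j) \<longleftrightarrow> mpoly_eval p (\<lambda>(i, k). \<beta> (c (u j k)) $ i) \<noteq> 0"
      if j: "j < nc" for j
    proof -
      have "c ` S \<subseteq> {1..q}" if "S \<in> set (xs ! j)" for S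
      proof -
        have "S \<subseteq> vertices I" using tuple[OF mem[OF j]] that by blast
        then show ?thesis using c by blast
      qed
      then show ?thesis
        using tuple[OF mem[OF j]] blocks[OF j]
        by (intro uniformly_rainbow_iff_mpoly_eval[OF C(1) p(1) cap \<beta>]) blast+
    qed
    obtain j where j: "j < nc" "F = xs ! j" using F xs(2) len_xs by (metis in_set_conv_nth)
    \<comment> \<open>Tuple \<open>j\<close> is expressed by the pivot tuples, with the coefficients
      in column \<open>j\<close> of the reduced matrix; these do not depend on the coloring.\<close>
    have "mpoly_eval p (\<lambda>(i, k). \<beta> (c (u j k)) $ i) =
        (\<Sum>k\<in>K. B $$ (k, j) * mpoly_eval p (\<lambda>(i, k'). \<beta> (c (u (piv k) k')) $ i))"
    proof (rule mpoly_eval_linear_relation[OF p, where V = "vertices I" and g = "\<lambda>v i. \<beta> (c v) $ i"])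
      show "1 \<le> d * l" using assms(1,2) by simp
      show "finite (vertices I)" using inst by (simp add: urfc_instance_def)
      show "u j ` {..<d * l} \<subseteq> vertices I" using u_V j(1) .
      show "u (piv k) ` {..<d * l} \<subseteq> vertices I" if "k \<in> K" for k
        using u_V that by (simp add: K_def)
      fix J w
      assume J: "length J = r" "set J \<subseteq> {..<d * l}" and w: "length w = r" "set w \<subseteq> vertices I"
      \<comment> \<open>The pair names a row of \<open>A\<close>, and the column relation read in
        that row is the required identity.\<close>
      have "(J, map enc_nat w) \<in> set keys"
        using J w vs(2) by (auto simp: keys_def row_keys_def set_n_lists)
      then obtain i where i: "i < nr" "keys ! i = (J, map enc_nat w)"
        by (metis in_set_conv_nth nr_def)
      have entry: "A $$ (i, j') = of_bool (map (u j') J = w)" if j': "j' < nc" for j'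
      proof -
        have "map (position d (ts ! j')) J = map enc_nat (map (u j') J)"
          using u[OF j'] J(2) by auto
        moreover have "inj enc_nat" using enc_nat_inject by (auto intro: injI)
        ultimately show ?thesis
          using i j' by (simp add: A_eq indicator_mat_def nr_def nc_def inj_map_eq_map del: map_map)
      qed
      have "A $$ (i, j) = (\<Sum>k\<in>K. B $$ (k, j) * A $$ (i, piv k))"
        unfolding K_def by (rule column_eq_pivot_columns[OF A B_def piv i(1) j(1)])
      then show "of_bool (map (u j) J = w) = (\<Sum>k\<in>K. B $$ (k, j) * of_bool (map (u (piv k)) J = w))"
        using entry j(1) by (simp add: K_def)
    qed
    also have "\<dots> = 0"
    proof (intro sum.neutral ballI)
      fix k assume k: "k \<in> K"
      \<comment> \<open>Pivot tuples belong to \<open>F'\<close>, so \<open>p\<close> vanishes on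
        each of them.\<close>
      then have "\<not> uniformly_rainbow d c (xs ! piv k)" using avoid by (simp add: F'_def)
      then show "B $$ (k, j) * mpoly_eval p (\<lambda>(i, k'). \<beta> (c (u (piv k) k')) $ i) = 0"
        using rainbow[of "piv k"] k by (simp add: K_def)
    qed
    finally show ?thesis using rainbow j by simp
  qed
  then have "urfc_solutions d q (I\<lparr>tuples := F'\<rparr>) = urfc_solutions d q I"
    using sub unfolding urfc_solutions_def by auto
  then show ?thesis using sub encodes card by blast
qed

section \<open>Number of edges and conclusion\<close>

lemma card_edges_le:
  assumes "urfc_instance d l I" and "r \<ge> 2"
  shows "card (edges I) \<le> card (vertices I) ^ r"
proof -
  let ?n = "card (vertices I)"
  have fin: "finite (vertices I)" using assms(1) by (simp add: urfc_instance_def)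
  have "edges I \<subseteq> (\<lambda>(a, b). {a, b}) ` (vertices I \<times> vertices I)"
  proof
    fix e assume "e \<in> edges I"
    then have "e \<subseteq> vertices I" "card e = 2" using assms(1) by (auto simp: urfc_instance_def)
    then obtain a b where "e = {a, b}" by (auto simp: card_2_iff)
    then show "e \<in> (\<lambda>(a, b). {a, b}) ` (vertices I \<times> vertices I)"
      using \<open>e \<subseteq> vertices I\<close> by auto
  qed
  then have "card (edges I) \<le> card (vertices I \<times> vertices I)"
    using fin by (meson card_image_le card_mono finite_SigmaI finite_imageI order_trans)
  also have "\<dots> = ?n ^ 2" by (simp add: card_cartesian_product power2_eq_square)
  \<comment> \<open>The assumption \<open>r \<ge> 2\<close> enters here. Powers increase with the
    exponent only for a base of at least 1, so the empty graph is treated separately.\<close>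
  also have "\<dots> \<le> ?n ^ r"
    using assms(2) by (cases "?n = 0") (auto intro: power_increasing)
  finally show ?thesis .
qed

theorem theorem5p2:
  fixes d l m q r :: nat
    and C :: "'f :: field vec set"
    and p :: "(nat \<times> nat, 'f) mpoly"
  assumes "d \<ge> 1" and "l \<ge> 1" and "m \<ge> 1" and "q \<ge> 1" and "r \<ge> 2" and "q \<ge> d"
    and "efficient_field TYPE('f)"
    and "C \<subseteq> carrier_vec m" and "card C = q"
    and "matrix_poly m (d * l) p" and "mpoly_degree p \<le> r"
    and "captures_uniformly_rainbow m d l q C p"
  shows "\<exists>\<kappa>. urfc_kernel d l q r \<kappa> \<and>
    (\<forall>I x. urfc_instance d l I \<and> encodes_urfc I x \<longrightarrow>
      (\<exists>F'. F' \<subseteq> tuples I \<and>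
        encodes_urfc (I\<lparr>tuples := F'\<rparr>) (\<kappa> x) \<and>
        urfc_solutions d q (I\<lparr>tuples := F'\<rparr>) = urfc_solutions d q I))"
proof -
  let ?\<kappa> = "kernel TYPE('f) d l r"
  \<comment> \<open>The cardinality of an infinite set is 0 by convention, while
    \<open>q \<ge> 1\<close>.\<close>
  have "finite C" using assms(4,9) by (metis card.infinite not_one_le_zero)
  note correct = kernel_correct[OF assms(1,2,8,9) this assms(10-12)]
  have "poly_time_computable {x. \<exists>I. urfc_instance d l I \<and> encodes_urfc I x} id id ?\<kappa>"
    using ptime_kernel[OF assms(7), of d l r] unfolding ptime_def poly_time_computable_def by blast
  moreover have "\<exists>I'. urfc_instance d l I' \<and> encodes_urfc I' (?\<kappa> x) \<and>
      (urfc_solutions d q I \<noteq> {} \<longleftrightarrow> urfc_solutions d q I' \<noteq> {}) \<and>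
      num_constraints I' \<le> ((d * l) ^ r + 1) * card (vertices I) ^ r"
    if I: "urfc_instance d l I" "encodes_urfc I x" for I x
  proof -
    obtain F' where F': "F' \<subseteq> tuples I" "encodes_urfc (I\<lparr>tuples := F'\<rparr>) (?\<kappa> x)"
      "urfc_solutions d q (I\<lparr>tuples := F'\<rparr>) = urfc_solutions d q I"
      "card F' \<le> (d * l) ^ r * card (vertices I) ^ r"
      using correct[OF I] by blast
    have "urfc_instance d l (I\<lparr>tuples := F'\<rparr>)"
    proof -
      have "length F = l \<and> (\<forall>S\<in>set F. S \<subseteq> vertices I \<and> card S = d)" if "F \<in> F'" for F
        using I(1) subsetD[OF F'(1) that] unfolding urfc_instance_def by simp
      then show ?thesis using I(1) unfolding urfc_instance_def by simp
    qed
    \<comment> \<open>In the constant, \<open>(d * l) ^ r\<close> pays for the tuples and 1 for the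
      edges.\<close>
    moreover have "num_constraints (I\<lparr>tuples := F'\<rparr>) \<le> ((d * l) ^ r + 1) * card (vertices I) ^ r"
      using card_edges_le[OF I(1) assms(5)] F'(4) by (simp add: num_constraints_def)
    ultimately show ?thesis using F'(2,3) by (intro exI[of _ "I\<lparr>tuples := F'\<rparr>"]) simp
  qed
  ultimately have "urfc_kernel d l q r ?\<kappa>"
    unfolding urfc_kernel_def by (intro conjI exI[of _ "(d * l) ^ r + 1"] allI impI) auto
  moreover have "\<exists>F'. F' \<subseteq> tuples I \<and> encodes_urfc (I\<lparr>tuples := F'\<rparr>) (?\<kappa> x) \<and>
      urfc_solutions d q (I\<lparr>tuples := F'\<rparr>) = urfc_solutions d q I"
    if "urfc_instance d l I" "encodes_urfc I x" for I x
    using correct[OF that] by blast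
  ultimately show ?thesis by (intro exI[of _ ?\<kappa>]) simp
qed

end
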